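(* Consider a single bandit with state space $\{0,1,2,\ldots\}$ and, for each $W\in\mathbb R$, the problem of minimizing over policies $\phi$ $$\mathbb{E}(T(N^\phi,S^\phi(N^\phi)))-W\,\mathbb{E}(f(N^\phi,S^\phi(N^\phi))).$$ If an optimal solution of this problem is of threshold type, and $\mathbb{E}(f(N^n,S^n(N^n)))$ is non-negative and strictly increasing in the threshold $n$, then the problem is indexable.
   Context: Bandit. A bandit is a controlled continuous-time Markov chain on $\{0,1,2,\ldots\}$ with two actions, $a=0$ (passive) and $a=1$ (active), whose transitions (at finite rates, or instantaneous) depend only on the current state and action. A policy $\phi$ is a map $S^\phi$ from states to $\{0,1\}$ under which the chain is ergodic; $N^\phi$ denotes a random variable with the stationary distribution of the state under $\phi$. $\mathbb E(T(N^\phi,S^\phi(N^\phi)))$ denotes the total expected stationary cost per unit of time under $\phi$ (state- and action-dependent costs per unit of time plus the cost per unit of time due to lump costs of instantaneous transitions). $f(n,a)$ is a given function of state and action, bounded by a polynomial in $n$ and equal to $0$ when the transition in state $n$ under action $a$ is instantaneous; $\mathbb E(f(N^\phi,S^\phi(N^\phi)))$ is its stationary mean. Threshold policies. An optimal solution is of threshold type if there is a threshold function $n(W)$ such that, in the problem with parameter $W$, action $a$ is optimal in states $m\le n(W)$ and action $a'$ is optimal in all other states, where $a,a'\in\{0,1\}$, $a\ne a'$. It is called 0-1 type if $a=0,a'=1$, and 1-0 type if $a=1,a'=0$. A superscript $n$ (as in $N^n,S^n$) refers to the threshold policy (of the given type) with threshold $n$. Indexability. Let $D(W)$ be the set of states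 in which passive is an optimal action in the problem with parameter $W$. The bandit (problem) is indexable if $D(W)$ increases in $W$, that is, $W'<W$ implies $D(W')\subseteq D(W)$. (Remark, not part of the definition: if $D(W)$ is instead decreasing in $W$, one can simply switch the roles of active and passive for the bandit, and the bandit would be indexable.)
   Formalization: Threshold type is read exactly: the states where action a is optimal are precisely m ≤ n(W) (a' may tie below). For 1-0 type, indexability is concluded for the bandit with active and passive switched. Otherwise the claim fails. *)

theory Defs
  imports Complex_Main "HOL-Library.Extended_Real" "HOL-Computational_Algebra.Polynomial"
begin

datatype action = Passive | Active

fun other :: "action \<Rightarrow> action" where
  "other Passive = Active"
| "other Active = Passive"

text \<open>
  In state \<open>n\<close> under action \<open>a\<close> the chain either jumps instantaneously, to \<open>m\<close> with probability
  \<open>jump n a m\<close> and at lump cost \<open>lump n a\<close>, or it jumps to \<open>m\<close> at rate \<open>rate n a m\<close> and incurs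
  \<open>cost n a\<close> per unit of time meanwhile. The field \<open>weight\<close> is the function \<open>f\<close> whose
  stationary mean is multiplied by \<open>W\<close> in the objective.
\<close>

record bandit =
  instantaneous :: "nat \<Rightarrow> action \<Rightarrow> bool"
  rate :: "nat \<Rightarrow> action \<Rightarrow> nat \<Rightarrow> real"
  jump :: "nat \<Rightarrow> action \<Rightarrow> nat \<Rightarrow> real"
  cost :: "nat \<Rightarrow> action \<Rightarrow> real"
  lump :: "nat \<Rightarrow> action \<Rightarrow> real"
  weight :: "nat \<Rightarrow> action \<Rightarrow> real"

definition valid_bandit :: "bandit \<Rightarrow> bool" where
  "valid_bandit B \<longleftrightarrow>
     (\<forall>n a. if instantaneous B n a then (\<forall>m. 0 \<le> jump B n a m) \<and> jump B n a sums 1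
            else (\<forall>m. 0 \<le> rate B n a m) \<and> summable (rate B n a)) \<and>
     (\<forall>n a. instantaneous B n a \<longrightarrow> weight B n a = 0) \<and>
     (\<exists>p :: real poly. \<forall>n a. \<bar>weight B n a\<bar> \<le> poly p (real n))"

type_synonym policy = "nat \<Rightarrow> action"

definition exit_rate :: "bandit \<Rightarrow> policy \<Rightarrow> nat \<Rightarrow> real" where
  "exit_rate B \<phi> n = (\<Sum>m. rate B n (\<phi> n) m)"

text \<open>Transition probabilities of the embedded jump chain, which also visits the states that are
  left instantaneously.\<close>

definition step :: "bandit \<Rightarrow> policy \<Rightarrow> nat \<Rightarrow> nat \<Rightarrow> real" where
  "step B \<phi> n m =
     (if instantaneous B n (\<phi> n) then jump B n (\<phi> n) m
      else if exit_rate B \<phi> n = 0 then of_bool (m = n)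
      else rate B n (\<phi> n) m / exit_rate B \<phi> n)"

text \<open>Probability that the jump chain started in \<open>n\<close> reaches \<open>z\<close> in at most \<open>k\<close> jumps.\<close>

primrec hit_within :: "bandit \<Rightarrow> policy \<Rightarrow> nat \<Rightarrow> nat \<Rightarrow> nat \<Rightarrow> real" where
  "hit_within B \<phi> z 0 n = of_bool (n = z)"
| "hit_within B \<phi> z (Suc k) n =
     (if n = z then 1 else (\<Sum>m. step B \<phi> n m * hit_within B \<phi> z k m))"

text \<open>
  Global balance: \<open>\<pi> n\<close> is the long-run fraction of time spent in \<open>n\<close>, and \<open>\<nu> n\<close> is the number of
  visits to \<open>n\<close> per unit of time. A state that is left instantaneously has \<open>\<pi> n = 0\<close>, but
  \<open>\<nu> n\<close> may be positive and determines the lump costs per unit of time.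
\<close>

definition stationary :: "bandit \<Rightarrow> policy \<Rightarrow> (nat \<Rightarrow> real) \<times> (nat \<Rightarrow> real) \<Rightarrow> bool" where
  "stationary B \<phi> = (\<lambda>(\<pi>, \<nu>).
     (\<forall>n. 0 \<le> \<pi> n) \<and> \<pi> sums 1 \<and> (\<forall>n. 0 \<le> \<nu> n) \<and>
     (\<forall>n. if instantaneous B n (\<phi> n) then \<pi> n = 0 else \<nu> n = \<pi> n * exit_rate B \<phi> n) \<and>
     (\<forall>n. (\<lambda>m. if instantaneous B m (\<phi> m) then \<nu> m * jump B m (\<phi> m) n
                else \<pi> m * rate B m (\<phi> m) n) sums \<nu> n))"

text \<open>
  Some state is reached almost surely from everywhere, so there is a single recurrent class
  (and no explosion), and it is positive recurrent. Transient states are allowed: for instance,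
  an instantaneous reset in state \<open>n\<close> can make the states above \<open>n\<close> unreachable.
\<close>

definition ergodic :: "bandit \<Rightarrow> policy \<Rightarrow> bool" where
  "ergodic B \<phi> \<longleftrightarrow>
     (\<exists>z. \<forall>n. (\<lambda>k. hit_within B \<phi> z k n) \<longlonglongrightarrow> 1) \<and> (\<exists>!x. stationary B \<phi> x)"

definition stat_prob :: "bandit \<Rightarrow> policy \<Rightarrow> nat \<Rightarrow> real" where
  "stat_prob B \<phi> = fst (THE x. stationary B \<phi> x)"

definition visit_rate :: "bandit \<Rightarrow> policy \<Rightarrow> nat \<Rightarrow> real" where
  "visit_rate B \<phi> = snd (THE x. stationary B \<phi> x)"

definition cost_rate :: "bandit \<Rightarrow> policy \<Rightarrow> nat \<Rightarrow> real" where
  "cost_rate B \<phi> n =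
     (if instantaneous B n (\<phi> n) then visit_rate B \<phi> n * lump B n (\<phi> n)
      else stat_prob B \<phi> n * cost B n (\<phi> n))"

definition mean_cost :: "bandit \<Rightarrow> policy \<Rightarrow> real" where
  "mean_cost B \<phi> = (\<Sum>n. cost_rate B \<phi> n)"

definition mean_weight :: "bandit \<Rightarrow> policy \<Rightarrow> real" where
  "mean_weight B \<phi> = (\<Sum>n. stat_prob B \<phi> n * weight B n (\<phi> n))"

text \<open>The expectations in the objective must exist; a divergent \<open>suminf\<close> would be a junk value.\<close>

definition admissible :: "bandit \<Rightarrow> policy \<Rightarrow> bool" where
  "admissible B \<phi> \<longleftrightarrow> ergodic B \<phi> \<and>
     summable (\<lambda>n. \<bar>cost_rate B \<phi> n\<bar>) \<and>
     summable (\<lambda>n. \<bar>stat_prob B \<phi> n * weight B n (\<phi> n)\<bar>)"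

text \<open>
  Below, \<open>\<Phi>\<close> is the class of policies over which the objective is minimized. The canonical choice
  is \<open>Collect (admissible B)\<close>; smaller classes (irreducible policies only, say) fit as well.
\<close>

definition objective :: "bandit \<Rightarrow> real \<Rightarrow> policy \<Rightarrow> real" where
  "objective B W \<phi> = mean_cost B \<phi> - W * mean_weight B \<phi>"

definition optimal :: "bandit \<Rightarrow> policy set \<Rightarrow> real \<Rightarrow> policy \<Rightarrow> bool" where
  "optimal B \<Phi> W \<phi> \<longleftrightarrow> \<phi> \<in> \<Phi> \<and> (\<forall>\<psi>\<in>\<Phi>. objective B W \<phi> \<le> objective B W \<psi>)"

definition optimal_action :: "bandit \<Rightarrow> policy set \<Rightarrow> real \<Rightarrow> nat \<Rightarrow> action \<Rightarrow> bool" where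
  "optimal_action B \<Phi> W m a \<longleftrightarrow> (\<exists>\<phi>. optimal B \<Phi> W \<phi> \<and> \<phi> m = a)"

definition passive_set :: "bandit \<Rightarrow> policy set \<Rightarrow> real \<Rightarrow> nat set" where
  "passive_set B \<Phi> W = {m. optimal_action B \<Phi> W m Passive}"

definition indexable :: "bandit \<Rightarrow> policy set \<Rightarrow> bool" where
  "indexable B \<Phi> \<longleftrightarrow> (\<forall>W' W. W' < W \<longrightarrow> passive_set B \<Phi> W' \<subseteq> passive_set B \<Phi> W)"

text \<open>The extreme thresholds \<open>-1\<close> and \<open>\<infinity>\<close> give the two constant policies.\<close>

definition thresholds :: "ereal set" where
  "thresholds = {-1, \<infinity>} \<union> range (\<lambda>n :: nat. ereal (real n))"

text \<open>The 0-1 type is \<open>a = Passive\<close>, the 1-0 type is \<open>a = Active\<close>.\<close>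

definition threshold_policy :: "action \<Rightarrow> ereal \<Rightarrow> policy" where
  "threshold_policy a n = (\<lambda>m. if ereal (real m) \<le> n then a else other a)"

text \<open>
  The threshold policy is optimal, and \<open>n W\<close> delimits the states in which \<open>a\<close> is optimal exactly.
  The action \<open>other a\<close> is then optimal in every state above \<open>n W\<close>, and may tie with \<open>a\<close> below it,
  as it does at the values of \<open>W\<close> where the threshold moves. Without exactness, a tie above
  \<open>n W\<close> would put states into the passive set that are unrelated to the threshold.
\<close>

definition threshold_type :: "bandit \<Rightarrow> policy set \<Rightarrow> action \<Rightarrow> bool" where
  "threshold_type B \<Phi> a \<longleftrightarrow>
     (\<exists>n. \<forall>W. n W \<in> thresholds \<and> optimal B \<Phi> W (threshold_policy a (n W)) \<and>
          (\<forall>m. optimal_action B \<Phi> W m a \<longleftrightarrow> ereal (real m) \<le> n W))"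

text \<open>The same controlled chain with the names of the two actions exchanged.\<close>

definition switch_roles :: "bandit \<Rightarrow> bandit" where
  "switch_roles B =
     \<lparr>instantaneous = (\<lambda>n a. instantaneous B n (other a)),
      rate = (\<lambda>n a. rate B n (other a)),
      jump = (\<lambda>n a. jump B n (other a)),
      cost = (\<lambda>n a. cost B n (other a)),
      lump = (\<lambda>n a. lump B n (other a)),
      weight = (\<lambda>n a. weight B n (other a))\<rparr>"

definition switch_policies :: "policy set \<Rightarrow> policy set" where
  "switch_policies \<Phi> = (\<lambda>\<phi>. other \<circ> \<phi>) ` \<Phi>"

end

theory Submission imports Defs begin

text \<open>
  Adding the two optimality inequalities of the optimal policies for \<open>W' < W\<close> cancels the mean
  costs, so the mean weight of an optimal policy is nondecreasing in \<open>W\<close>. As the mean weight is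
  strictly increasing in the threshold, the optimal threshold is nondecreasing in \<open>W\<close>, and so is the
  set of states below it. In the 1-0 type these are the active states, which the exchange of the two
  actions turns into the passive ones.
\<close>

lemma optimal_mean_weight_mono:
  assumes "optimal B \<Phi> W' \<phi>'" and "optimal B \<Phi> W \<phi>" and "W' < W"
  shows "mean_weight B \<phi>' \<le> mean_weight B \<phi>"
proof -
  have "objective B W' \<phi>' \<le> objective B W' \<phi>" and "objective B W \<phi> \<le> objective B W \<phi>'"
    using assms(1,2) by (auto simp: optimal_def)
  then have "(W - W') * (mean_weight B \<phi>' - mean_weight B \<phi>) \<le> 0"
    by (simp add: objective_def algebra_simps)
  with \<open>W' < W\<close> show ?thesis
    by (simp add: mult_le_0_iff)
qed

text \<open>Stated for the action \<open>a\<close> below the threshold, so that one argument serves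
  both types. The exactness clause of \<open>threshold_type\<close> turns the comparison of two
  thresholds into an inclusion of sets of states.\<close>

lemma threshold_type_optimal_action_mono:
  assumes "threshold_type B \<Phi> a"
    and mono: "strict_mono_on {n \<in> thresholds. threshold_policy a n \<in> \<Phi>}
           (\<lambda>n. mean_weight B (threshold_policy a n))"
    and "W' < W" and "optimal_action B \<Phi> W' m a"
  shows "optimal_action B \<Phi> W m a"
proof -
  obtain n where n: "\<And>W. n W \<in> thresholds" "\<And>W. optimal B \<Phi> W (threshold_policy a (n W))"
    and action: "\<And>W m. optimal_action B \<Phi> W m a \<longleftrightarrow> ereal (real m) \<le> n W"
    using assms(1) unfolding threshold_type_def by blast
  \<comment> \<open>Optimality includes membership in \<Phi>, so both thresholds lie where the mean
    weight is strictly increasing.\<close>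
  have "n V \<in> {n \<in> thresholds. threshold_policy a n \<in> \<Phi>}" for V
    using n by (auto simp: optimal_def)
  moreover have "mean_weight B (threshold_policy a (n W')) \<le> mean_weight B (threshold_policy a (n W))"
    using optimal_mean_weight_mono[OF n(2) n(2) \<open>W' < W\<close>] .
  \<comment> \<open>Thresholds are linearly ordered: \<open>n W < n W'\<close> would make the mean
    weight at \<open>W\<close> strictly smaller than at \<open>W'\<close>.\<close>
  ultimately have "n W' \<le> n W"
    using strict_mono_onD[OF mono] by (meson not_le)
  then show ?thesis
    using assms(4) action order_trans by blast
qed

lemma other_other [simp]: "other (other a) = a"
  by (cases a) simp_all

lemma switch_roles_simps [simp]:
  "instantaneous (switch_roles B) n a = instantaneous B n (other a)"
  "rate (switch_roles B) n a = rate B n (other a)"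
  "jump (switch_roles B) n a = jump B n (other a)"
  "cost (switch_roles B) n a = cost B n (other a)"
  "lump (switch_roles B) n a = lump B n (other a)"
  "weight (switch_roles B) n a = weight B n (other a)"
  by (simp_all add: switch_roles_def)

text \<open>The two exchanges cancel: in every state the same rates and jump probabilities are
  selected, so the balance equations coincide.\<close>

lemma stationary_switch_roles: "stationary (switch_roles B) (other \<circ> \<phi>) = stationary B \<phi>"
  by (simp add: stationary_def exit_rate_def cong: if_cong)

lemma objective_switch_roles: "objective (switch_roles B) W (other \<circ> \<phi>) = objective B W \<phi>"
proof -
  \<comment> \<open>Both sides are components of a definite description over the same
    predicate.\<close>
  have "stat_prob (switch_roles B) (other \<circ> \<phi>) = stat_prob B \<phi>"
    and "visit_rate (switch_roles B) (other \<circ> \<phi>) = visit_rate B \<phi>"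
    by (simp_all add: stat_prob_def visit_rate_def stationary_switch_roles)
  then show ?thesis
    by (simp add: objective_def mean_cost_def mean_weight_def cost_rate_def cong: if_cong)
qed

lemma optimal_switch_roles:
  "optimal (switch_roles B) (switch_policies \<Phi>) W (other \<circ> \<phi>) \<longleftrightarrow> optimal B \<Phi> W \<phi>"
proof -
  \<comment> \<open>The exchange is its own inverse. Injectivity lets membership in the image of
    \<Phi> be pulled back to \<Phi>.\<close>
  have "inj (\<lambda>\<phi> :: policy. other \<circ> \<phi>)"
    by (rule inj_on_inverseI[where g = "\<lambda>\<phi>. other \<circ> \<phi>"]) (simp add: fun_eq_iff)
  then show ?thesis
    by (simp add: optimal_def switch_policies_def objective_switch_roles inj_image_mem_iff)
qed

lemma optimal_action_switch_roles:
  "optimal_action (switch_roles B) (switch_policies \<Phi>) W m (other a) \<longleftrightarrow> optimal_action B \<Phi> W m a"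
proof -
  \<comment> \<open>Every policy is an exchanged one, so a witness for the switched bandit also
    yields one for \<open>B\<close>.\<close>
  have "\<phi> = other \<circ> (other \<circ> \<phi>)" for \<phi> :: policy
    by (simp add: fun_eq_iff)
  then show ?thesis
    unfolding optimal_action_def by (metis optimal_switch_roles comp_apply other_other)
qed

theorem proposition2:
  fixes B :: bandit and \<Phi> :: "policy set" and a :: action
  assumes "valid_bandit B"
    and "\<Phi> \<subseteq> Collect (admissible B)"
    and "threshold_type B \<Phi> a"
    and "\<And>n. n \<in> thresholds \<Longrightarrow> threshold_policy a n \<in> \<Phi> \<Longrightarrow>
           0 \<le> mean_weight B (threshold_policy a n)"
    and "strict_mono_on {n \<in> thresholds. threshold_policy a n \<in> \<Phi>}
           (\<lambda>n. mean_weight B (threshold_policy a n))"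
  shows "(a = Passive \<longrightarrow> indexable B \<Phi>) \<and>
         (a = Active \<longrightarrow> indexable (switch_roles B) (switch_policies \<Phi>))"
proof -
  have mono: "optimal_action B \<Phi> W' m a \<Longrightarrow> optimal_action B \<Phi> W m a" if "W' < W" for W' W m
    using threshold_type_optimal_action_mono[OF assms(3,5) that] .
  have "indexable B \<Phi>" if "a = Passive"
    using mono that by (auto simp: indexable_def passive_set_def)
  moreover have "indexable (switch_roles B) (switch_policies \<Phi>)" if "a = Active"
    using mono that optimal_action_switch_roles[of B \<Phi> _ _ Active]
    by (auto simp: indexable_def passive_set_def)
  ultimately show ?thesis
    by blast
qed

end
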